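(* Let $\frac14(1+\sqrt2)\le\sigma\le1$. For all positive integers $n$, a red-blue copy of $K_n$ with $\sigma\binom n2$ red edges has at most $\frac12\sigma^3(1-\sigma)n^4+O(n^3)$ $RRRB$-cycles. Furthermore, for all $0<\delta<10^{-6}$ there exists $n_0$ such that whenever $n\ge n_0$ and $G$ is a red-blue copy of $K_n$ with $\sigma\binom n2$ red edges and more than $\frac12\sigma^3(1-\sigma)n^4-\delta n^4$ $RRRB$-cycles, the red graph $R$ of $G$ is $(4\delta^{1/8})$-quasirandom of density $\sigma$.
   Context: A red-blue $K_n$ is a complete graph on $n$ vertices each of whose edges is coloured red or blue; its red graph $R$ consists of the red edges. An $RRRB$-cycle is a $4$-cycle (counted as a subgraph) with exactly three red edges and one blue edge. For $\varepsilon>0$, an $n$-vertex graph $J$ of density $\sigma=e(J)/\binom n2$ is $\varepsilon$-quasirandom if $\sum_{x\neq y}\left||N_J(x)\cap N_J(y)|-\sigma^2n\right|<\varepsilon n^3$ (sum over ordered pairs of distinct vertices). *)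

theory Defs
  imports Complex_Main "HOL-Library.Ramsey"
begin

text \<open>
  A graph is given by a vertex set \<open>V\<close> and an edge set \<open>E \<subseteq> nsets V 2\<close>. A red-blue complete graph
  on \<open>V\<close> is a colouring of two-element vertex sets; its values outside \<open>nsets V 2\<close> are irrelevant.
\<close>

datatype colour = Red | Blue

definition colour_class :: "'a set \<Rightarrow> ('a set \<Rightarrow> colour) \<Rightarrow> colour \<Rightarrow> 'a set set" where
  "colour_class V col k = {e \<in> nsets V 2. col e = k}"

text \<open>
  A 4-cycle is counted as a subgraph, hence identified with its edge set: each one arises from
  eight sequences \<open>(a, b, c, d)\<close> but occurs once in this set.
\<close>

definition four_cycles :: "'a set \<Rightarrow> 'a set set set" where
  "four_cycles V =
     {{{a, b}, {b, c}, {c, d}, {d, a}} | a b c d. {a, b, c, d} \<subseteq> V \<and> distinct [a, b, c, d]}"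

definition RRRB_cycles :: "'a set \<Rightarrow> ('a set \<Rightarrow> colour) \<Rightarrow> 'a set set set" where
  "RRRB_cycles V col =
     {F \<in> four_cycles V. card (F \<inter> colour_class V col Red) = 3 \<and>
                         card (F \<inter> colour_class V col Blue) = 1}"

definition edge_density :: "'a set \<Rightarrow> 'a set set \<Rightarrow> real" where
  "edge_density V E = real (card E) / real (card V choose 2)"

definition neighbourhood :: "'a set set \<Rightarrow> 'a \<Rightarrow> 'a set" where
  "neighbourhood E x = {y. {x, y} \<in> E}"

definition quasirandom :: "real \<Rightarrow> 'a set \<Rightarrow> 'a set set \<Rightarrow> bool" where
  "quasirandom \<epsilon> V E \<longleftrightarrow>
     (\<Sum>(x, y) \<in> {(x, y). x \<in> V \<and> y \<in> V \<and> x \<noteq> y}.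
        \<bar>real (card (neighbourhood E x \<inter> neighbourhood E y))
          - (edge_density V E)\<^sup>2 * real (card V)\<bar>) < \<epsilon> * real (card V) ^ 3"

end

theory Submission
  imports Defs "HOL-Analysis.Convex"
begin

text \<open>
  Write \<open>d\<close> for the red degree, \<open>t x y\<close> for the red codegree, \<open>e = d - \<sigma> n\<close> and
  \<open>s x y = \<sigma>\<^sup>2 n + (e x + e y) / 4\<close>. Twice the number of RRRB-cycles is at most the number of red walks
  \<open>u v w z\<close> whose closing pair \<open>z u\<close> is not red, which is the sum of \<open>t u w * (d w - t u w)\<close> over
  all \<open>u\<close> and \<open>w\<close>. After symmetrising, completing the square around \<open>s\<close> makes the coefficient of \<open>t\<close> constant,
  and the sum becomes
  \<open>\<sigma>\<^sup>3 (1 - \<sigma>) n\<^sup>4 + (\<sigma> - 2 \<sigma>\<^sup>2 + 1/8) n \<Sum>e\<^sup>2 - \<Sum>(t - s)\<^sup>2\<close> up to a term of order \<open>n\<^sup>3\<close>.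
  The middle coefficient is, for \<open>\<sigma> \<ge> 0\<close>, nonpositive exactly when
  \<open>\<sigma> \<ge> (1 + sqrt 2) / 4\<close>.

  If the bound is nearly attained, then \<open>\<Sum>(t - s)\<^sup>2\<close> is small. As \<open>\<Sum>t = \<Sum>d\<^sup>2\<close>, the sum of
  \<open>t - s\<close> equals \<open>\<Sum>e\<^sup>2\<close> up to a term of order \<open>n\<^sup>2\<close>, so \<open>\<Sum>e\<^sup>2\<close> is small too, and Cauchy-Schwarz
  turns both into a bound for \<open>\<Sum>\<bar>t - \<sigma>\<^sup>2 n\<bar>\<close>.
\<close>

section \<open>Cauchy-Schwarz, and degree and codegree sums of a symmetric kernel\<close>

lemma sum_abs_le_of_sum_sq:
  fixes f :: "'b \<Rightarrow> real"
  assumes "(\<Sum>i\<in>I. (f i)\<^sup>2) * real (card I) \<le> c\<^sup>2" "c \<ge> 0"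
  shows "(\<Sum>i\<in>I. \<bar>f i\<bar>) \<le> c"
proof (rule power2_le_imp_le)
  show "(\<Sum>i\<in>I. \<bar>f i\<bar>)\<^sup>2 \<le> c\<^sup>2"
    using sum_squared_le_sum_of_squares[of "\<lambda>i. \<bar>f i\<bar>" I] assms(1) by simp
qed fact

text \<open>The moment computations rest on symmetry and total weight alone. The total is taken over
  ordered pairs, hence twice \<sigma> times the number of edges of the complete graph.\<close>

locale symmetric_kernel =
  fixes V :: "'a set" and A :: "'a \<Rightarrow> 'a \<Rightarrow> real" and \<sigma> :: real
  assumes finite_V: "finite V"
    and sym: "A x y = A y x"
    and total: "(\<Sum>x\<in>V. \<Sum>y\<in>V. A x y) = \<sigma> * (real (card V) * (real (card V) - 1))"
begin

abbreviation n :: real where "n \<equiv> real (card V)"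

definition deg :: "'a \<Rightarrow> real" where
  "deg x = (\<Sum>y\<in>V. A x y)"

definition codeg :: "'a \<Rightarrow> 'a \<Rightarrow> real" where
  "codeg x y = (\<Sum>z\<in>V. A x z * A z y)"

definition dev :: "'a \<Rightarrow> real" where
  "dev x = deg x - \<sigma> * n"

text \<open>The weight 1/4 makes \<open>2 * approx x y\<close> differ from the mean of
  \<open>deg x\<close> and \<open>deg y\<close> by a constant.\<close>

definition approx :: "'a \<Rightarrow> 'a \<Rightarrow> real" where
  "approx x y = \<sigma>\<^sup>2 * n + (dev x + dev y) / 4"

definition dev_energy :: real where
  "dev_energy = (\<Sum>x\<in>V. (dev x)\<^sup>2)"

definition residue :: real where
  "residue = (\<Sum>x\<in>V. \<Sum>y\<in>V. (codeg x y - approx x y)\<^sup>2)"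

lemma codeg_commute: "codeg x y = codeg y x"
  unfolding codeg_def by (intro sum.cong refl) (metis mult.commute sym)

lemma dev_energy_nonneg: "dev_energy \<ge> 0"
  unfolding dev_energy_def by (simp add: sum_nonneg)

text \<open>The mean degree is \<open>\<sigma> * (n - 1)\<close>, not \<open>\<sigma> * n\<close>.
  This shift is the source of all lower-order terms below.\<close>

lemma sum_dev: "(\<Sum>x\<in>V. dev x) = - \<sigma> * n"
  using total by (simp add: dev_def deg_def sum_subtractf algebra_simps)

text \<open>Grouping walks of length two by their middle vertex gives the sum of squared degrees,
  which is then expanded around \<open>\<sigma> * n\<close>.\<close>

lemma sum_codeg: "(\<Sum>x\<in>V. \<Sum>y\<in>V. codeg x y) = \<sigma>\<^sup>2 * n ^ 3 - 2 * \<sigma>\<^sup>2 * n\<^sup>2 + dev_energy"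
proof -
  have "(\<Sum>x\<in>V. \<Sum>y\<in>V. codeg x y) = (\<Sum>x\<in>V. \<Sum>z\<in>V. A x z * deg z)"
    unfolding codeg_def deg_def sum_distrib_left by (intro sum.cong refl sum.swap)
  also have "\<dots> = (\<Sum>z\<in>V. \<Sum>x\<in>V. A x z * deg z)"
    by (rule sum.swap)
  also have "\<dots> = (\<Sum>z\<in>V. (deg z)\<^sup>2)"
    unfolding sum_distrib_right[symmetric] power2_eq_square deg_def
    by (intro sum.cong refl arg_cong2[where f = "(*)"] sym)
  also have "\<dots> = (\<Sum>z\<in>V. (\<sigma> * n)\<^sup>2 + 2 * \<sigma> * n * dev z + (dev z)\<^sup>2)"
    by (intro sum.cong refl) (simp add: dev_def power2_eq_square algebra_simps)
  also have "\<dots> = n * (\<sigma> * n)\<^sup>2 + 2 * \<sigma> * n * (\<Sum>z\<in>V. dev z) + dev_energy"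
    by (simp add: sum.distrib dev_energy_def sum_distrib_left)
  finally show ?thesis
    unfolding sum_dev by (simp add: power2_eq_square power3_eq_cube algebra_simps)
qed

lemma sum_dev_add: "(\<Sum>x\<in>V. \<Sum>y\<in>V. dev x + dev y) = - 2 * \<sigma> * n\<^sup>2"
proof -
  have "(\<Sum>x\<in>V. \<Sum>y\<in>V. dev x + dev y) = 2 * (n * (\<Sum>x\<in>V. dev x))"
    by (simp add: sum.distrib sum_distrib_left[symmetric])
  then show ?thesis
    unfolding sum_dev by (simp add: power2_eq_square)
qed

lemma sum_dev_add_sq:
  "(\<Sum>x\<in>V. \<Sum>y\<in>V. (dev x + dev y)\<^sup>2) = 2 * n * dev_energy + 2 * \<sigma>\<^sup>2 * n\<^sup>2"
proof -
  have "(\<Sum>x\<in>V. \<Sum>y\<in>V. (dev x + dev y)\<^sup>2)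
      = (\<Sum>x\<in>V. \<Sum>y\<in>V. (dev x)\<^sup>2 + 2 * (dev x * dev y) + (dev y)\<^sup>2)"
    by (simp add: power2_eq_square algebra_simps)
  also have "\<dots> = 2 * n * dev_energy + 2 * ((\<Sum>x\<in>V. dev x) * (\<Sum>y\<in>V. dev y))"
    by (simp add: sum.distrib sum_distrib_left[symmetric] sum_distrib_right[symmetric]
        dev_energy_def)
  finally show ?thesis
    unfolding sum_dev by (simp add: power2_eq_square)
qed

lemma sum_approx: "(\<Sum>x\<in>V. \<Sum>y\<in>V. approx x y) = \<sigma>\<^sup>2 * n ^ 3 - \<sigma> * n\<^sup>2 / 2"
proof -
  \<comment> \<open>An arbitrary \<open>g\<close> keeps \<open>dev x + dev y\<close> as one summand,
    the form that \<open>sum_dev_add\<close> evaluates.\<close>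
  have "(\<Sum>x\<in>V. \<Sum>y\<in>V. \<sigma>\<^sup>2 * n + g x y / 4)
      = n * (n * (\<sigma>\<^sup>2 * n)) + (\<Sum>x\<in>V. \<Sum>y\<in>V. g x y) / 4" for g :: "'a \<Rightarrow> 'a \<Rightarrow> real"
    by (simp add: sum.distrib sum_divide_distrib[symmetric])
  from this[of "\<lambda>x y. dev x + dev y"]
  have "(\<Sum>x\<in>V. \<Sum>y\<in>V. approx x y)
      = n * (n * (\<sigma>\<^sup>2 * n)) + (\<Sum>x\<in>V. \<Sum>y\<in>V. dev x + dev y) / 4"
    by (simp only: approx_def)
  then show ?thesis
    unfolding sum_dev_add by (simp add: power2_eq_square power3_eq_cube)
qed

lemma sum_approx_sq:
  "(\<Sum>x\<in>V. \<Sum>y\<in>V. (approx x y)\<^sup>2)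
     = \<sigma> ^ 4 * n ^ 4 - \<sigma> ^ 3 * n ^ 3 + n * dev_energy / 8 + \<sigma>\<^sup>2 * n\<^sup>2 / 8"
proof -
  have split: "(\<Sum>x\<in>V. \<Sum>y\<in>V. a + b * g x y + h x y / 16)
      = n * (n * a) + b * (\<Sum>x\<in>V. \<Sum>y\<in>V. g x y) + (\<Sum>x\<in>V. \<Sum>y\<in>V. h x y) / 16"
    for a b :: real and g h :: "'a \<Rightarrow> 'a \<Rightarrow> real"
    by (simp add: sum.distrib sum_distrib_left[symmetric] sum_divide_distrib[symmetric])
  have "(\<Sum>x\<in>V. \<Sum>y\<in>V. (approx x y)\<^sup>2)
      = (\<Sum>x\<in>V. \<Sum>y\<in>V. (\<sigma>\<^sup>2 * n)\<^sup>2 + \<sigma>\<^sup>2 * n / 2 * (dev x + dev y) + (dev x + dev y)\<^sup>2 / 16)"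
    by (intro sum.cong refl) (simp add: approx_def power2_eq_square field_simps)
  also have "\<dots> = n * (n * (\<sigma>\<^sup>2 * n)\<^sup>2) + \<sigma>\<^sup>2 * n / 2 * (\<Sum>x\<in>V. \<Sum>y\<in>V. dev x + dev y)
      + (\<Sum>x\<in>V. \<Sum>y\<in>V. (dev x + dev y)\<^sup>2) / 16"
    by (rule split)
  finally show ?thesis
    unfolding sum_dev_add sum_dev_add_sq
    by (simp add: power2_eq_square power3_eq_cube power4_eq_xxxx field_simps)
qed

text \<open>For a graph, \<open>codeg x y\<close> counts the second vertices and
  \<open>deg y - codeg x y\<close> the fourth vertices of a walk with first vertex \<open>x\<close>
  and third vertex \<open>y\<close> whose ends are not adjacent.\<close>

lemma open_walk_sum_eq:
  "(\<Sum>x\<in>V. \<Sum>y\<in>V. codeg x y * (deg y - codeg x y))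
     = \<sigma> ^ 3 * (1 - \<sigma>) * n ^ 4 + (\<sigma> - 2 * \<sigma>\<^sup>2 + 1 / 8) * (n * dev_energy)
       + (4 * \<sigma> ^ 4 - 3 * \<sigma> ^ 3) * n ^ 3 + \<sigma>\<^sup>2 * n\<^sup>2 / 8 - residue"
proof -
  let ?S = "\<lambda>f. \<Sum>x\<in>V. \<Sum>y\<in>V. f x y :: real"
  have "?S (\<lambda>x y. codeg x y * (deg y - codeg x y)) = ?S (\<lambda>x y. codeg x y * (deg x - codeg x y))"
    by (subst sum.swap) (simp add: codeg_commute)
  then have "2 * ?S (\<lambda>x y. codeg x y * (deg y - codeg x y))
      = ?S (\<lambda>x y. codeg x y * (deg x - codeg x y) + codeg x y * (deg y - codeg x y))"
    by (simp add: sum.distrib)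
  \<comment> \<open>The mean of \<open>deg x\<close> and \<open>deg y\<close> is
    \<open>2 * approx x y + (\<sigma> - 2 * \<sigma>\<^sup>2) * n\<close>.\<close>
  also have "\<dots> = ?S (\<lambda>x y. 2 * ((\<sigma> - 2 * \<sigma>\<^sup>2) * n * codeg x y + (approx x y)\<^sup>2
                         - (codeg x y - approx x y)\<^sup>2))"
    by (intro sum.cong refl) (simp add: approx_def dev_def power2_eq_square field_simps)
  also have "\<dots> = 2 * ((\<sigma> - 2 * \<sigma>\<^sup>2) * n * ?S codeg + ?S (\<lambda>x y. (approx x y)\<^sup>2) - residue)"
    by (simp only: sum.distrib sum_subtractf sum_distrib_left[symmetric] residue_def)
  finally show ?thesis
    unfolding sum_codeg sum_approx_sq
    by (simp add: power2_eq_square power3_eq_cube power4_eq_xxxx field_simps)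
qed

lemma open_walk_sum_le:
  assumes \<sigma>: "\<sigma> \<ge> (1 + sqrt 2) / 4" "\<sigma> \<le> 1" and n: "n \<ge> 1"
  shows "(\<Sum>x\<in>V. \<Sum>y\<in>V. codeg x y * (deg y - codeg x y))
     \<le> \<sigma> ^ 3 * (1 - \<sigma>) * n ^ 4 + 2 * n ^ 3 - residue"
proof -
  have pos: "\<sigma> \<ge> 0"
    using \<sigma>(1) order_trans[of 0 "(1 + sqrt 2) / 4" \<sigma>] by simp
  \<comment> \<open>The coefficient of \<open>n * dev_energy\<close> is
    \<open>(2 - (4 * \<sigma> - 1)\<^sup>2) / 8\<close>.\<close>
  have "(4 * \<sigma> - 1)\<^sup>2 \<ge> (sqrt 2)\<^sup>2"
    using \<sigma>(1) by (intro power_mono) auto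
  then have "\<sigma> - 2 * \<sigma>\<^sup>2 + 1 / 8 \<le> 0"
    by (simp add: power2_eq_square algebra_simps)
  then have 1: "(\<sigma> - 2 * \<sigma>\<^sup>2 + 1 / 8) * (n * dev_energy) \<le> 0"
    using dev_energy_nonneg by (simp add: mult_nonpos_nonneg)
  have "\<sigma> ^ 3 * (4 * \<sigma> - 3) \<le> \<sigma> ^ 3 * 1"
    using \<sigma>(2) pos by (intro mult_left_mono) auto
  also have "\<dots> \<le> 1"
    using \<sigma>(2) pos by (simp add: power_le_one)
  finally have "\<sigma> ^ 3 * (4 * \<sigma> - 3) \<le> 1" .
  then have 2: "(4 * \<sigma> ^ 4 - 3 * \<sigma> ^ 3) * n ^ 3 \<le> 1 * n ^ 3"
    by (intro mult_right_mono) (auto simp: algebra_simps power3_eq_cube power4_eq_xxxx)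
  have "\<sigma>\<^sup>2 * n\<^sup>2 \<le> 1 * n ^ 3"
    using \<sigma>(2) pos n by (intro mult_mono power_le_one power_increasing) auto
  moreover have "n ^ 3 \<ge> 0"
    by simp
  ultimately have "\<sigma>\<^sup>2 * n\<^sup>2 / 8 \<le> n ^ 3"
    by linarith
  with 1 2 show ?thesis
    unfolding open_walk_sum_eq by linarith
qed

text \<open>Here \<open>q\<close> plays the role of the eighth root of \<delta>. Each of two uses of
  Cauchy-Schwarz halves the exponent: from \<open>q ^ 8\<close> for \<open>residue\<close> to
  \<open>q ^ 4\<close> for \<open>dev_energy\<close>, and then to \<open>q\<^sup>2\<close> for the
  sum of absolute degree deviations.\<close>

lemma sum_codeg_deviation_less:
  assumes \<sigma>: "0 \<le> \<sigma>" "\<sigma> \<le> 1" and q: "0 < q" "q < 1" and n: "n * q ^ 8 \<ge> 2"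
    and res: "residue \<le> 3 * q ^ 8 * n ^ 4"
  shows "(\<Sum>x\<in>V. \<Sum>y\<in>V. \<bar>codeg x y - \<sigma>\<^sup>2 * n\<bar>) < 4 * q * n ^ 3"
proof -
  have npos: "n > 0"
    using n by (cases "card V = 0") auto
  have "n * q ^ 8 \<le> n * q ^ 4"
    using q by (intro mult_left_mono power_decreasing) auto
  with n have n4: "n * q ^ 4 \<ge> 2"
    by linarith
  have cs: "(\<Sum>x\<in>V. \<Sum>y\<in>V. \<bar>codeg x y - approx x y\<bar>) \<le> 2 * q ^ 4 * n ^ 3"
  proof -
    have "residue * real (card (V \<times> V)) \<le> 3 * q ^ 8 * n ^ 4 * n\<^sup>2"
      using res by (simp add: card_cartesian_product power2_eq_square mult_right_mono)
    \<comment> \<open>Raising 3 to 4 produces a perfect square.\<close>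
    also have "\<dots> \<le> 4 * q ^ 8 * n ^ 4 * n\<^sup>2"
      using q by (intro mult_right_mono) auto
    also have "\<dots> = (2 * q ^ 4 * n ^ 3)\<^sup>2"
      by (simp add: power_mult_distrib flip: power_mult power_add)
    finally have "(\<Sum>(x, y)\<in>V \<times> V. \<bar>codeg x y - approx x y\<bar>) \<le> 2 * q ^ 4 * n ^ 3"
      using sum_abs_le_of_sum_sq[of "\<lambda>(x, y). codeg x y - approx x y" "V \<times> V"] q
      by (simp add: residue_def sum.cartesian_product case_prod_unfold)
    then show ?thesis
      by (simp add: sum.cartesian_product)
  qed
  \<comment> \<open>The energy appears linearly in the sum of codegrees but not in that of
    \<open>approx\<close>, so the first-moment bound controls it. The quadratic term is absorbed
    through \<open>n * q ^ 4 \<ge> 2\<close>.\<close>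
  have "dev_energy = (\<Sum>x\<in>V. \<Sum>y\<in>V. codeg x y - approx x y) + 2 * \<sigma>\<^sup>2 * n\<^sup>2 - \<sigma> * n\<^sup>2 / 2"
    using sum_codeg sum_approx by (simp add: sum_subtractf)
  moreover have "(\<Sum>x\<in>V. \<Sum>y\<in>V. codeg x y - approx x y) \<le> 2 * q ^ 4 * n ^ 3"
    using cs by (rule order_trans[rotated]) (intro sum_mono, simp)
  moreover have "\<sigma>\<^sup>2 * n\<^sup>2 \<le> 1 * n\<^sup>2"
    using \<sigma> by (intro mult_right_mono power_le_one) auto
  moreover have "2 * n\<^sup>2 \<le> n * q ^ 4 * n\<^sup>2"
    using n4 by (intro mult_right_mono) auto
  moreover have "n * q ^ 4 * n\<^sup>2 = q ^ 4 * n ^ 3" "\<sigma> * n\<^sup>2 \<ge> 0" "q ^ 4 * n ^ 3 \<ge> 0"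
    using \<sigma> q by (simp_all add: power2_eq_square power3_eq_cube)
  ultimately have "dev_energy \<le> 4 * q ^ 4 * n ^ 3"
    by linarith
  then have "dev_energy * n \<le> 4 * q ^ 4 * n ^ 3 * n"
    by (intro mult_right_mono) auto
  also have "\<dots> = (2 * q\<^sup>2 * n\<^sup>2)\<^sup>2"
    by (simp add: power_mult_distrib power3_eq_cube power4_eq_xxxx power2_eq_square)
  finally have dev: "(\<Sum>x\<in>V. \<bar>dev x\<bar>) \<le> 2 * q\<^sup>2 * n\<^sup>2"
    by (intro sum_abs_le_of_sum_sq) (auto simp: dev_energy_def)
  have "(\<Sum>x\<in>V. \<Sum>y\<in>V. \<bar>codeg x y - \<sigma>\<^sup>2 * n\<bar>)
      \<le> (\<Sum>x\<in>V. \<Sum>y\<in>V. \<bar>codeg x y - approx x y\<bar> + (\<bar>dev x\<bar> + \<bar>dev y\<bar>) / 4)"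
    unfolding approx_def by (intro sum_mono) argo
  also have "\<dots> = (\<Sum>x\<in>V. \<Sum>y\<in>V. \<bar>codeg x y - approx x y\<bar>) + n * (\<Sum>x\<in>V. \<bar>dev x\<bar>) / 2"
    by (simp add: sum.distrib sum_divide_distrib[symmetric] sum_distrib_left[symmetric])
  also have "\<dots> \<le> 2 * q ^ 4 * n ^ 3 + n * (2 * q\<^sup>2 * n\<^sup>2) / 2"
    using cs dev by (intro add_mono divide_right_mono mult_left_mono) auto
  also have "\<dots> = (2 * q ^ 4 + q ^ 2) * n ^ 3"
    by (simp add: power2_eq_square power3_eq_cube algebra_simps)
  also have "\<dots> < 4 * q * n ^ 3"
  proof (rule mult_strict_right_mono)
    have "q ^ 4 \<le> q" "q ^ 2 \<le> q"
      using q power_decreasing[of 1 _ q] by auto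
    then show "2 * q ^ 4 + q ^ 2 < 4 * q"
      using q by linarith
  qed (use npos in auto)
  finally show ?thesis .
qed

end

section \<open>Edges and RRRB-cycles counted by ordered tuples\<close>

lemma sum_edge_indicator:
  assumes "finite V" "E \<subseteq> nsets V 2"
  shows "(\<Sum>x\<in>V. \<Sum>y\<in>V. of_bool ({x, y} \<in> E)) = 2 * real (card E)"
proof -
  let ?P = "{p \<in> V \<times> V. {fst p, snd p} \<in> E}"
  have "finite E"
    using assms finite_imp_finite_nsets finite_subset by blast
  \<comment> \<open>Diagonal pairs give singletons, which are not in \<open>nsets V 2\<close>, so
    each edge comes from exactly its two orientations.\<close>
  have two: "card {p \<in> ?P. {fst p, snd p} = e} = 2" if "e \<in> E" for e
  proof -
    from that assms(2) obtain u v where uv: "e = {u, v}" "u \<noteq> v" "u \<in> V" "v \<in> V"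
      by (blast elim: nsets2_E)
    then have "{p \<in> ?P. {fst p, snd p} = e} = {(u, v), (v, u)}"
      using that by (auto simp: doubleton_eq_iff insert_commute)
    then show ?thesis
      using uv(2) by simp
  qed
  have "(\<Sum>x\<in>V. \<Sum>y\<in>V. of_bool ({x, y} \<in> E)) = (\<Sum>p\<in>V \<times> V. of_bool ({fst p, snd p} \<in> E) :: real)"
    by (simp add: sum.cartesian_product case_prod_unfold)
  also have "\<dots> = real (card ?P)"
    using assms(1) by (simp add: Int_def)
  also have "card ?P = (\<Sum>e\<in>E. card {p \<in> ?P. {fst p, snd p} = e})"
    unfolding card_eq_sum using assms(1) \<open>finite E\<close> by (intro sum.group[symmetric]) auto
  also have "\<dots> = 2 * card E"
    using two by simp
  finally show ?thesis
    by simp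
qed

text \<open>The cycle is rotated until its blue edge is the closing pair; the four cases are the
  positions of that edge.\<close>

lemma RRRB_cycle_path:
  assumes "F \<in> RRRB_cycles V col"
  obtains a b c d where "F = {{a, b}, {b, c}, {c, d}, {d, a}}" "{a, b, c, d} \<subseteq> V" "a \<noteq> d"
    "{a, b} \<in> colour_class V col Red" "{b, c} \<in> colour_class V col Red"
    "{c, d} \<in> colour_class V col Red" "{d, a} \<notin> colour_class V col Red"
proof -
  let ?R = "colour_class V col Red" and ?B = "colour_class V col Blue"
  from assms obtain a b c d where F: "F = {{a, b}, {b, c}, {c, d}, {d, a}}"
    and V: "{a, b, c, d} \<subseteq> V" and dist: "distinct [a, b, c, d]" and "card (F \<inter> ?B) = 1"
    unfolding RRRB_cycles_def four_cycles_def by blast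
  then obtain e where e: "F \<inter> ?B = {e}"
    by (auto simp: card_1_singleton_iff)
  have edge: "f \<in> nsets V 2" if "f \<in> F" for f
    using that V dist unfolding F by auto
  have red: "f \<in> ?R" if "f \<in> F" "f \<noteq> e" for f
    using that e edge[OF that(1)] unfolding colour_class_def by (cases "col f") auto
  have "e \<in> ?B"
    using e by blast
  then have blue: "e \<notin> ?R"
    by (simp add: colour_class_def)
  have "e \<in> F"
    using e by auto
  then consider "e = {d, a}" | "e = {a, b}" | "e = {b, c}" | "e = {c, d}"
    unfolding F by auto
  then show thesis
  proof cases
    case 1
    show ?thesis
      by (rule that[of a b c d]) (use 1 V dist red blue in \<open>auto simp: F doubleton_eq_iff\<close>)
  next
    case 2
    show ?thesis
      by (rule that[of b c d a]) (use 2 V dist red blue in \<open>auto simp: F doubleton_eq_iff\<close>)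
  next
    case 3
    show ?thesis
      by (rule that[of c d a b]) (use 3 V dist red blue in \<open>auto simp: F doubleton_eq_iff\<close>)
  next
    case 4
    show ?thesis
      by (rule that[of d a b c]) (use 4 V dist red blue in \<open>auto simp: F doubleton_eq_iff\<close>)
  qed
qed

text \<open>Each cycle yields its red path in both directions. The surplus walks have
  \<open>a = d\<close> and come from red triangles, so they cost only order \<open>n ^ 3\<close>.
  The first and third vertices lead the tuple to match the sum over codegrees.\<close>

lemma card_RRRB_cycles_le_open_walks:
  fixes V :: "'a set" and col :: "'a set \<Rightarrow> colour"
  assumes "finite V"
  defines "R \<equiv> colour_class V col Red"
  shows "2 * card (RRRB_cycles V col)
    \<le> card {(a, c, b, d) \<in> V \<times> V \<times> V \<times> V. {a, b} \<in> R \<and> {b, c} \<in> R \<and> {c, d} \<in> R \<and> {d, a} \<notin> R}"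
    (is "_ \<le> card ?Q")
proof -
  define Q where "Q = ?Q"
  define cyc :: "'a \<times> 'a \<times> 'a \<times> 'a \<Rightarrow> 'a set set"
    where "cyc = (\<lambda>(a, c, b, d). {{a, b}, {b, c}, {c, d}, {d, a}})"
  define rev :: "'a \<times> 'a \<times> 'a \<times> 'a \<Rightarrow> 'a \<times> 'a \<times> 'a \<times> 'a"
    where "rev = (\<lambda>(a, c, b, d). (d, b, c, a))"
  have "\<exists>p. cyc p = F \<and> p \<in> Q \<and> rev p \<noteq> p" if "F \<in> RRRB_cycles V col" for F
  proof -
    from that obtain a b c d where "F = {{a, b}, {b, c}, {c, d}, {d, a}}" "{a, b, c, d} \<subseteq> V" "a \<noteq> d"
      "{a, b} \<in> R" "{b, c} \<in> R" "{c, d} \<in> R" "{d, a} \<notin> R"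
      unfolding R_def by (rule RRRB_cycle_path)
    then show ?thesis
      by (intro exI[of _ "(a, c, b, d)"]) (simp add: cyc_def rev_def Q_def)
  qed
  then obtain p where p: "\<And>F. F \<in> RRRB_cycles V col \<Longrightarrow> cyc (p F) = F \<and> p F \<in> Q \<and> rev (p F) \<noteq> p F"
    by metis
  have cyc_rev: "cyc (rev x) = cyc x" for x
    by (cases x) (auto simp: cyc_def rev_def insert_commute)
  have rev_Q: "rev x \<in> Q" if "x \<in> Q" for x
    using that by (cases x) (simp add: Q_def rev_def insert_commute)
  \<comment> \<open>The boolean selects the direction. Injectivity holds because \<open>cyc\<close>
    recovers \<open>F\<close> and the two directions differ, their ends being distinct.\<close>
  define f where "f = (\<lambda>(F, u). if u then p F else rev (p F))"
  have cyc_f: "cyc (f (F, u)) = F" if "F \<in> RRRB_cycles V col" for F u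
    using p[OF that] cyc_rev by (simp add: f_def)
  have "card (RRRB_cycles V col \<times> (UNIV :: bool set)) \<le> card Q"
  proof (rule card_inj_on_le)
    show "inj_on f (RRRB_cycles V col \<times> UNIV)"
    proof (rule inj_onI, clarify)
      fix F u G v
      assume FG: "F \<in> RRRB_cycles V col" "G \<in> RRRB_cycles V col" and eq: "f (F, u) = f (G, v)"
      then have "F = G"
        using cyc_f by metis
      with eq p[OF FG(1)] show "F = G \<and> u = v"
        by (cases u; cases v) (auto simp: f_def)
    qed
    show "f ` (RRRB_cycles V col \<times> UNIV) \<subseteq> Q"
    proof (rule image_subsetI, clarify)
      fix F u assume "F \<in> RRRB_cycles V col"
      then show "f (F, u) \<in> Q"
        using p rev_Q by (simp add: f_def)
    qed
    show "finite Q"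
      unfolding Q_def by (rule finite_subset[of _ "V \<times> V \<times> V \<times> V"]) (use assms(1) in auto)
  qed
  then show ?thesis
    by (simp add: card_cartesian_product Q_def)
qed

section \<open>The red graph as a 0/1 kernel\<close>

locale red_blue_graph =
  fixes V :: "'a set" and col :: "'a set \<Rightarrow> colour" and \<sigma> :: real
  assumes finite_vertices: "finite V"
    and card_red: "real (card (colour_class V col Red)) = \<sigma> * real (card V choose 2)"
begin

abbreviation R :: "'a set set" where "R \<equiv> colour_class V col Red"

lemma R_subset: "R \<subseteq> nsets V 2"
  by (auto simp: colour_class_def)

sublocale symmetric_kernel V "\<lambda>x y. of_bool ({x, y} \<in> R)" \<sigma>
proof
  have "2 * real (m choose 2) = real m * (real m - 1)" for m
    by (induction m) (auto simp: numeral_2_eq_2 algebra_simps)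
  then show "(\<Sum>x\<in>V. \<Sum>y\<in>V. of_bool ({x, y} \<in> R)) = \<sigma> * (real (card V) * (real (card V) - 1))"
    unfolding sum_edge_indicator[OF finite_vertices R_subset] card_red by (metis mult.left_commute)
qed (auto simp: finite_vertices insert_commute)

lemma codeg_eq_card: "codeg x y = real (card (neighbourhood R x \<inter> neighbourhood R y))"
proof -
  have "codeg x y = (\<Sum>z\<in>V. of_bool (z \<in> neighbourhood R x \<inter> neighbourhood R y))"
    unfolding codeg_def neighbourhood_def by (intro sum.cong) (auto simp: insert_commute)
  also have "\<dots> = real (card (V \<inter> (neighbourhood R x \<inter> neighbourhood R y)))"
    using finite_vertices by (simp add: Int_def)
  also have "V \<inter> (neighbourhood R x \<inter> neighbourhood R y) = neighbourhood R x \<inter> neighbourhood R y"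
    using R_subset by (auto simp: neighbourhood_def)
  finally show ?thesis .
qed

text \<open>Once the first and third vertices are fixed, the second and fourth are chosen
  independently, so the count of open walks factorises.\<close>

lemma card_RRRB_cycles_le_open_walk_sum:
  "2 * real (card (RRRB_cycles V col)) \<le> (\<Sum>x\<in>V. \<Sum>y\<in>V. codeg x y * (deg y - codeg x y))"
proof -
  let ?A = "\<lambda>x y. of_bool ({x, y} \<in> R) :: real"
  let ?Q = "{(a, c, b, d) \<in> V \<times> V \<times> V \<times> V. {a, b} \<in> R \<and> {b, c} \<in> R \<and> {c, d} \<in> R \<and> {d, a} \<notin> R}"
  have inner: "codeg a c * (deg c - codeg a c)
      = (\<Sum>b\<in>V. \<Sum>d\<in>V. ?A a b * ?A b c * (?A c d * (1 - ?A d a)))" for a c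
  proof -
    have "deg c - codeg a c = (\<Sum>d\<in>V. ?A c d * (1 - ?A d a))"
      unfolding codeg_commute[of a c] unfolding codeg_def deg_def
      by (simp only: sum_subtractf[symmetric] right_diff_distrib mult_1_right)
    then show ?thesis
      by (simp only: codeg_def sum_product)
  qed
  have "2 * real (card (RRRB_cycles V col)) \<le> real (card ?Q)"
    using card_RRRB_cycles_le_open_walks[OF finite_vertices, of col] by linarith
  also have "\<dots> = (\<Sum>p\<in>V \<times> V \<times> V \<times> V. of_bool (p \<in> ?Q))"
  proof -
    have "V \<times> V \<times> V \<times> V \<inter> ?Q = ?Q"
      by auto
    then show ?thesis
      using finite_vertices by simp
  qed
  also have "\<dots> = (\<Sum>(a, c, b, d)\<in>V \<times> V \<times> V \<times> V. ?A a b * ?A b c * (?A c d * (1 - ?A d a)))"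
    by (intro sum.cong refl) auto
  also have "\<dots> = (\<Sum>a\<in>V. \<Sum>c\<in>V. codeg a c * (deg c - codeg a c))"
    by (simp only: inner sum.cartesian_product)
  finally show ?thesis .
qed

text \<open>Keeping \<open>residue\<close> lets one inequality serve both claims: dropping it gives
  the upper bound, solving for it gives stability.\<close>

lemma card_RRRB_cycles_le:
  assumes "\<sigma> \<ge> (1 + sqrt 2) / 4" "\<sigma> \<le> 1" "n \<ge> 1"
  shows "real (card (RRRB_cycles V col)) \<le> 1 / 2 * \<sigma> ^ 3 * (1 - \<sigma>) * n ^ 4 + n ^ 3 - residue / 2"
  using open_walk_sum_le[OF assms] card_RRRB_cycles_le_open_walk_sum by simp

lemma red_quasirandom:
  assumes \<sigma>: "\<sigma> \<ge> (1 + sqrt 2) / 4" "\<sigma> \<le> 1" and \<delta>: "0 < \<delta>" "\<delta> < 1" and large: "n * \<delta> \<ge> 2"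
    and many: "real (card (RRRB_cycles V col)) > 1 / 2 * \<sigma> ^ 3 * (1 - \<sigma>) * n ^ 4 - \<delta> * n ^ 4"
  shows "edge_density V R = \<sigma>" and "quasirandom (4 * \<delta> powr (1 / 8)) V R"
proof -
  have "2 * \<delta> < n * \<delta>"
    using large \<delta>(2) by linarith
  then have n: "n > 2"
    using \<delta>(1) by simp
  \<comment> \<open>Otherwise the quotient in \<open>edge_density\<close> would default to
    0.\<close>
  then have "card V choose 2 > 0"
    by simp
  then show density: "edge_density V R = \<sigma>"
    using card_red by (simp add: edge_density_def)
  \<comment> \<open>Of the three copies of \<open>\<delta> * n ^ 4\<close> bounding
    \<open>residue\<close>, two come from doubling the allowed loss and one absorbs the cubic
    error.\<close>
  have "2 * n ^ 3 \<le> n * \<delta> * n ^ 3"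
    using large by (intro mult_right_mono) auto
  then have "2 * n ^ 3 \<le> \<delta> * n ^ 4"
    by (simp add: power3_eq_cube power4_eq_xxxx algebra_simps)
  then have res: "residue \<le> 3 * \<delta> * n ^ 4"
    using card_RRRB_cycles_le[OF \<sigma>] many n by simp
  define q where "q = \<delta> powr (1 / 8)"
  have q8: "q ^ 8 = \<delta>"
    using \<delta>(1) by (simp add: q_def powr_power)
  have q: "0 < q" "q < 1"
    using \<delta> powr_less_mono2[of "1 / 8" \<delta> 1] by (auto simp: q_def)
  have "\<sigma> \<ge> 0"
    using \<sigma>(1) order_trans[of 0 "(1 + sqrt 2) / 4" \<sigma>] by simp
  then have "(\<Sum>x\<in>V. \<Sum>y\<in>V. \<bar>codeg x y - \<sigma>\<^sup>2 * n\<bar>) < 4 * q * n ^ 3"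
    using sum_codeg_deviation_less[OF _ \<sigma>(2) q] large res by (simp add: q8)
  \<comment> \<open>Discarding the nonnegative diagonal terms only lowers the sum.\<close>
  moreover have "(\<Sum>(x, y)\<in>{(x, y). x \<in> V \<and> y \<in> V \<and> x \<noteq> y}. \<bar>codeg x y - \<sigma>\<^sup>2 * n\<bar>)
      \<le> (\<Sum>x\<in>V. \<Sum>y\<in>V. \<bar>codeg x y - \<sigma>\<^sup>2 * n\<bar>)"
    unfolding sum.cartesian_product by (intro sum_mono2) (auto simp: finite_vertices)
  ultimately show "quasirandom (4 * \<delta> powr (1 / 8)) V R"
    unfolding quasirandom_def density codeg_eq_card q_def by linarith
qed

end

theorem theorem2p7:
  shows "(\<exists>C::real. \<forall>\<sigma> \<in> {(1 + sqrt 2) / 4 .. 1}. \<forall>n::nat. n \<ge> 1 \<longrightarrow>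
            (\<forall>(V :: nat set) col.
               finite V \<and> card V = n \<and>
               real (card (colour_class V col Red)) = \<sigma> * real (n choose 2) \<longrightarrow>
               real (card (RRRB_cycles V col))
                 \<le> 1 / 2 * \<sigma> ^ 3 * (1 - \<sigma>) * real n ^ 4 + C * real n ^ 3))
       \<and> (\<forall>\<sigma> \<in> {(1 + sqrt 2) / 4 .. 1}. \<forall>\<delta>::real. 0 < \<delta> \<and> \<delta> < 1 / 10 ^ 6 \<longrightarrow>
            (\<exists>n0::nat. \<forall>n \<ge> n0. \<forall>(V :: nat set) col.
               finite V \<and> card V = n \<and>
               real (card (colour_class V col Red)) = \<sigma> * real (n choose 2) \<and>
               real (card (RRRB_cycles V col))
                 > 1 / 2 * \<sigma> ^ 3 * (1 - \<sigma>) * real n ^ 4 - \<delta> * real n ^ 4 \<longrightarrow>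
               edge_density V (colour_class V col Red) = \<sigma> \<and>
               quasirandom (4 * \<delta> powr (1 / 8)) V (colour_class V col Red)))"
proof (intro conjI exI[of _ "1::real"] ballI allI impI)
  fix \<sigma> :: real and n :: nat and V :: "nat set" and col
  assume \<sigma>: "\<sigma> \<in> {(1 + sqrt 2) / 4..1}" and "1 \<le> n"
    and H: "finite V \<and> card V = n \<and> real (card (colour_class V col Red)) = \<sigma> * real (n choose 2)"
  interpret red_blue_graph V col \<sigma>
    using H by unfold_locales auto
  have "residue \<ge> 0"
    by (simp add: residue_def sum_nonneg)
  then show "real (card (RRRB_cycles V col))
      \<le> 1 / 2 * \<sigma> ^ 3 * (1 - \<sigma>) * real n ^ 4 + 1 * real n ^ 3"
    using card_RRRB_cycles_le \<sigma> H \<open>1 \<le> n\<close> by simp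
next
  fix \<sigma> \<delta> :: real
  assume \<sigma>: "\<sigma> \<in> {(1 + sqrt 2) / 4..1}" and \<delta>: "0 < \<delta> \<and> \<delta> < 1 / 10 ^ 6"
  show "\<exists>n0::nat. \<forall>n\<ge>n0. \<forall>(V :: nat set) col.
      finite V \<and> card V = n \<and> real (card (colour_class V col Red)) = \<sigma> * real (n choose 2) \<and>
      real (card (RRRB_cycles V col)) > 1 / 2 * \<sigma> ^ 3 * (1 - \<sigma>) * real n ^ 4 - \<delta> * real n ^ 4 \<longrightarrow>
      edge_density V (colour_class V col Red) = \<sigma> \<and>
      quasirandom (4 * \<delta> powr (1 / 8)) V (colour_class V col Red)"
  \<comment> \<open>This threshold is exactly what gives
    \<open>n * \<delta> \<ge> 2\<close>.\<close>
  proof (intro exI[of _ "nat \<lceil>2 / \<delta>\<rceil>"] allI impI)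
    fix n :: nat and V :: "nat set" and col
    assume n: "n \<ge> nat \<lceil>2 / \<delta>\<rceil>"
      and H: "finite V \<and> card V = n \<and> real (card (colour_class V col Red)) = \<sigma> * real (n choose 2) \<and>
        real (card (RRRB_cycles V col)) > 1 / 2 * \<sigma> ^ 3 * (1 - \<sigma>) * real n ^ 4 - \<delta> * real n ^ 4"
    interpret red_blue_graph V col \<sigma>
      using H by unfold_locales auto
    have "real n * \<delta> \<ge> 2"
      using n \<delta> by (simp add: nat_le_iff ceiling_le_iff divide_le_eq)
    then show "edge_density V (colour_class V col Red) = \<sigma> \<and>
        quasirandom (4 * \<delta> powr (1 / 8)) V (colour_class V col Red)"
      using red_quasirandom[of \<delta>] \<sigma> \<delta> H by auto
  qed
qed

end
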